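(* Let $\mathbf h^k$ be a feasible path flow vector (an iterate of a traffic assignment solver) and let $\mathcal{F}(\mathbf h^k)=\mathcal{L}(\mathbf h^k)-\mathbf h^k$. Apply GMRES, initialized at the zero vector, to the reduced Newton system $(\mathbf I-\mathcal{K}(\mathbf h^k))\,\boldsymbol\delta=\mathcal{F}(\mathbf h^k)$. Then the iterate $\boldsymbol\delta^k$ it produces preserves demand, that is, $\sum_{j\in\mathbb{P}_{OD}}\delta^k_j=0$ for every OD pair.
   Context: Network setting. There is a finite set $\mathbb{L}$ of links and a finite nonempty set of origin-destination (OD) pairs. Each OD pair has a demand $d_{OD}\ge 0$ and a fixed finite nonempty set $\mathbb{P}_{OD}$ of acyclic paths; $\mathbb{P}$ is the disjoint union of the $\mathbb{P}_{OD}$, $n=|\mathbb{P}|$, and $OD(i)$ is the OD pair of path $i$. $\mathbf{D}\in\{0,1\}^{|\mathbb{L}|\times n}$ is the link-path incidence matrix ($D_{li}=1$ iff link $l$ is on path $i$). A vector $\mathbf{h}\in\mathbb{R}^n$ is a feasible path flow vector if $h_i\ge 0$ for all $i$ and $\sum_{i\in\mathbb{P}_{OD}}h_i=d_{OD}$ for every OD pair. Costs. The cost of link $l$ depends only on its own flow $a_l$ via $\tau_l:[0,\infty)\to[0,\infty)$, which is twice continuously differentiable and monotone non-decreasing, with $\tau_l'$ Lipschitz on the bounded set of link flows arising from feasible path flows. Link flows are $\mathbf a=\mathbf D\mathbf h$, path costs are $\mathcal{C}(\mathbf h)=\mathbf{D}^T\mathcal{T}(\mathbf{D}\mathbf{h})$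 with $\mathcal{T}_l(\mathbf a)=\tau_l(a_l)$, and the Jacobian is $\mathcal{C}'(\mathbf h)=\mathbf D^T\operatorname{diag}(\tau_l'(a_l))\mathbf D$. Logit model. $\theta>0$ is a fixed parameter. For a path cost vector $\mathbf c$, $\mathcal{P}(\mathbf c)_i=\exp(-\theta c_i)/\sum_{i'\in\mathbb{P}_{OD(i)}}\exp(-\theta c_{i'})$. Put $\mathcal{H}(\mathbf h,\mathbf p)_i=\bigl(\sum_{i'\in\mathbb{P}_{OD(i)}}h_{i'}\bigr)p_i$. The logit mapping is $\mathcal{L}(\mathbf h)=\mathcal{H}(\mathbf h,\mathcal{P}(\mathcal{C}(\mathbf h)))$. $\mathcal{P}'(\mathbf c)$ is the Jacobian of $\mathcal{P}$, and $\mathcal{H}'_{\mathbf p}(\mathbf h)$ is the Jacobian of $\mathcal{H}$ in $\mathbf p$ with $\mathbf h$ fixed (for feasible $\mathbf h$, the diagonal matrix with entries $d_{OD(i)}$). The reduced Jacobian is $\mathcal{K}(\mathbf h)=\mathcal{H}'_{\mathbf p}(\mathbf h)\,\mathcal{P}'(\mathbf c)\,\mathcal{C}'(\mathbf h)$ with $\mathbf c=\mathcal{C}(\mathbf h)$. GMRES. For a system $\mathbf A\boldsymbol\delta=\mathbf r$ and initialization at $\mathbf 0$, GMRES with Krylov dimension $b\ge1$ produces the vector minimizing $\|\mathbf r-\mathbf A\boldsymbol\delta\|$ ($\ell_2$ norm) over $\boldsymbol\delta\in\mathrm{span}\{\mathbf r,\mathbf A\mathbf r,\dots,\mathbf A^{b-1}\mathbf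 r\}$; GMRES stops at the smallest $b$ at which a prescribed relative residual tolerance is met. Here $\mathbf A=\mathbf I-\mathcal{K}(\mathbf h^k)$ and $\mathbf r=\mathcal{F}(\mathbf h^k)$. *)

theory Defs
  imports "HOL-Analysis.Analysis" "Graph_Theory.Arc_Walk"
begin

text \<open>
  The links are the arcs of \<^term>\<open>network M\<close>; \<^typ>\<open>'l\<close> serves as row index of matrices and
  may have elements that are not links (their incidence rows vanish and their costs are not
  constrained). \<^typ>\<open>'p\<close> is exactly the index set of the paths of all OD pairs, so path vectors
  live in \<^typ>\<open>real ^ 'p\<close>; \<^term>\<open>od_of M i\<close> is the OD pair (origin, destination) of path \<^term>\<open>i\<close>
  and \<^term>\<open>links_of M i\<close> its sequence of links.
\<close>

record ('v, 'l, 'p) traffic_model =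
  network :: "('v, 'l) pre_digraph"
  od_pairs :: "('v \<times> 'v) set"
  demand :: "'v \<times> 'v \<Rightarrow> real"
  od_of :: "'p \<Rightarrow> 'v \<times> 'v"
  links_of :: "'p \<Rightarrow> 'l list"
  link_cost :: "'l \<Rightarrow> real \<Rightarrow> real"
  theta :: real

definition paths_of :: "('v, 'l, 'p) traffic_model \<Rightarrow> 'v \<times> 'v \<Rightarrow> 'p set" where
  "paths_of M w = {i. od_of M i = w}"

definition incidence :: "('v, 'l, 'p) traffic_model \<Rightarrow> real ^ 'p ^ 'l" where
  "incidence M = (\<chi> l i. if l \<in> set (links_of M i) then 1 else 0)"

definition feasible :: "('v, 'l, 'p::finite) traffic_model \<Rightarrow> real ^ 'p \<Rightarrow> bool" where
  "feasible M h \<longleftrightarrow>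
     (\<forall>i. 0 \<le> h $ i) \<and> (\<forall>w\<in>od_pairs M. (\<Sum>i\<in>paths_of M w. h $ i) = demand M w)"

definition link_flow :: "('v, 'l, 'p::finite) traffic_model \<Rightarrow> real ^ 'p \<Rightarrow> real ^ 'l" where
  "link_flow M h = incidence M *v h"

text \<open>
  Link costs are functions on \<^term>\<open>{0..} :: real set\<close>, so their derivatives are taken within
  this set (one-sided at 0).
\<close>

definition nonneg_C2 :: "(real \<Rightarrow> real) \<Rightarrow> bool" where
  "nonneg_C2 f \<longleftrightarrow> (\<exists>f' f''.
     (\<forall>x\<ge>0. (f has_real_derivative f' x) (at x within {0..})) \<and>
     (\<forall>x\<ge>0. (f' has_real_derivative f'' x) (at x within {0..})) \<and>
     continuous_on {0..} f'')"

definition link_cost_deriv :: "('v, 'l, 'p) traffic_model \<Rightarrow> 'l \<Rightarrow> real \<Rightarrow> real" where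
  "link_cost_deriv M l x = vector_derivative (link_cost M l) (at x within {0..})"

definition path_cost :: "('v, 'l::finite, 'p::finite) traffic_model \<Rightarrow> real ^ 'p \<Rightarrow> real ^ 'p" where
  "path_cost M h = transpose (incidence M) *v (\<chi> l. link_cost M l (link_flow M h $ l))"

definition path_cost_jacobian ::
    "('v, 'l::finite, 'p::finite) traffic_model \<Rightarrow> real ^ 'p \<Rightarrow> real ^ 'p ^ 'p" where
  "path_cost_jacobian M h =
     transpose (incidence M)
       ** (\<chi> l m. if l = m then link_cost_deriv M l (link_flow M h $ l) else 0)
       ** incidence M"

definition traffic_assignment :: "('v, 'l::finite, 'p::finite) traffic_model \<Rightarrow> bool" where
  "traffic_assignment M \<longleftrightarrow>
     wf_digraph (network M) \<and>
     finite (od_pairs M) \<and> od_pairs M \<noteq> {} \<and>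
     (\<forall>w\<in>od_pairs M. 0 \<le> demand M w) \<and>
     (\<forall>i. od_of M i \<in> od_pairs M) \<and>
     (\<forall>w\<in>od_pairs M. paths_of M w \<noteq> {}) \<and>
     (\<forall>i. pre_digraph.apath (network M) (fst (od_of M i)) (links_of M i) (snd (od_of M i))) \<and>
     inj (\<lambda>i. (od_of M i, links_of M i)) \<and>
     (\<forall>l\<in>arcs (network M).
        (\<forall>x\<ge>0. 0 \<le> link_cost M l x) \<and>
        nonneg_C2 (link_cost M l) \<and>
        mono_on {0..} (link_cost M l) \<and>
        (\<exists>C. C-lipschitz_on {link_flow M h $ l | h. feasible M h} (link_cost_deriv M l))) \<and>
     0 < theta M"

definition logit_prob :: "('v, 'l, 'p::finite) traffic_model \<Rightarrow> real ^ 'p \<Rightarrow> real ^ 'p" where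
  "logit_prob M c =
     (\<chi> i. exp (- theta M * c $ i) / (\<Sum>j\<in>paths_of M (od_of M i). exp (- theta M * c $ j)))"

definition spread :: "('v, 'l, 'p::finite) traffic_model \<Rightarrow> real ^ 'p \<Rightarrow> real ^ 'p \<Rightarrow> real ^ 'p" where
  "spread M h p = (\<chi> i. (\<Sum>j\<in>paths_of M (od_of M i). h $ j) * p $ i)"

definition logit_map :: "('v, 'l::finite, 'p::finite) traffic_model \<Rightarrow> real ^ 'p \<Rightarrow> real ^ 'p" where
  "logit_map M h = spread M h (logit_prob M (path_cost M h))"

definition logit_residual ::
    "('v, 'l::finite, 'p::finite) traffic_model \<Rightarrow> real ^ 'p \<Rightarrow> real ^ 'p" where
  "logit_residual M h = logit_map M h - h"

text \<open>
  \<^term>\<open>spread M h\<close> is linear in its last argument, so the base point of its Jacobian is immaterial.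
\<close>

definition reduced_jacobian ::
    "('v, 'l::finite, 'p::finite) traffic_model \<Rightarrow> real ^ 'p \<Rightarrow> real ^ 'p ^ 'p" where
  "reduced_jacobian M h =
     (let c = path_cost M h in
       jacobian (spread M h) (at (logit_prob M c))
         ** jacobian (logit_prob M) (at c)
         ** path_cost_jacobian M h)"

definition krylov :: "real ^ 'n ^ 'n \<Rightarrow> real ^ 'n \<Rightarrow> nat \<Rightarrow> (real ^ 'n::finite) set" where
  "krylov A r b = span ((\<lambda>k. ((*v) A ^^ k) r) ` {..<b})"

definition gmres_iterate ::
    "real ^ 'n ^ 'n \<Rightarrow> real ^ 'n \<Rightarrow> nat \<Rightarrow> real ^ 'n::finite \<Rightarrow> bool" where
  "gmres_iterate A r b \<delta> \<longleftrightarrow> is_arg_min (\<lambda>x. norm (r - A *v x)) (\<lambda>x. x \<in> krylov A r b) \<delta>"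

text \<open>
  The relative residual criterion is multiplied out, so it is met trivially if \<^prop>\<open>r = 0\<close>. For
  singular \<^term>\<open>A\<close> minimizers need not be unique, but they all have the same residual norm, so
  the stopping dimension \<^term>\<open>b\<close> does not depend on the choice of minimizers.
\<close>

definition gmres_meets ::
    "real ^ 'n ^ 'n \<Rightarrow> real ^ 'n \<Rightarrow> real \<Rightarrow> nat \<Rightarrow> real ^ 'n::finite \<Rightarrow> bool" where
  "gmres_meets A r tol b \<delta> \<longleftrightarrow> gmres_iterate A r b \<delta> \<and> norm (r - A *v \<delta>) \<le> tol * norm r"

definition gmres_output ::
    "real ^ 'n ^ 'n \<Rightarrow> real ^ 'n \<Rightarrow> real \<Rightarrow> real ^ 'n::finite \<Rightarrow> bool" where
  "gmres_output A r tol \<delta> \<longleftrightarrow>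
     (\<exists>b\<ge>1. gmres_meets A r tol b \<delta> \<and> (\<forall>b'. 1 \<le> b' \<and> b' < b \<longrightarrow> \<not> (\<exists>\<delta>'. gmres_meets A r tol b' \<delta>')))"

lemma link_cost_deriv:
  assumes "traffic_assignment M" "l \<in> arcs (network M)" "0 \<le> x"
  shows "(link_cost M l has_real_derivative link_cost_deriv M l x) (at x within {0..})"
proof -
  from assms have "nonneg_C2 (link_cost M l)"
    by (simp add: traffic_assignment_def)
  with assms(3) obtain D where D: "(link_cost M l has_real_derivative D) (at x within {0..})"
    unfolding nonneg_C2_def by metis
  have "at_right x \<le> at x within {0..}"
    using assms(3) by (intro at_le) auto
  then have "at x within {0..} \<noteq> bot"
    by (metis bot.extremum_uniqueI trivial_limit_at_right_real)
  with D have "link_cost_deriv M l x = D"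
    unfolding link_cost_deriv_def
    by (intro vector_derivative_within) (simp_all add: has_real_derivative_iff_has_vector_derivative)
  with D show ?thesis by simp
qed

lemma path_cost_jacobian:
  assumes M: "traffic_assignment M" and h: "\<And>i. 0 \<le> h $ i"
  shows "(path_cost M has_derivative (*v) (path_cost_jacobian M h)) (at h within {h. \<forall>i. 0 \<le> h $ i})"
    (is "(_ has_derivative _) (at h within ?S)")
proof -
  have nonneg: "0 \<le> link_flow M x $ l" if "x \<in> ?S" for x l
    using that by (auto simp: link_flow_def incidence_def matrix_vector_mult_def intro!: sum_nonneg)
  have arc: "l \<in> arcs (network M)" if "l \<in> set (links_of M i)" for l i
    using M that by (auto simp: traffic_assignment_def pre_digraph.apath_def pre_digraph.awalk_def)
  have lin: "((\<lambda>x. link_flow M x $ l) has_derivative (\<lambda>x. link_flow M x $ l)) (at h within ?S)" for l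
    unfolding link_flow_def
    by (intro bounded_linear.has_derivative[OF bounded_linear_vec_nth] bounded_linear_imp_has_derivative
        matrix_vector_mul_bounded_linear)
  have cost_term: "((\<lambda>x. incidence M $ l $ i * link_cost M l (link_flow M x $ l)) has_derivative
      (\<lambda>x. incidence M $ l $ i * (link_cost_deriv M l (link_flow M h $ l) * link_flow M x $ l)))
      (at h within ?S)" for l i
  proof (cases "l \<in> set (links_of M i)")
    case True
    have "(link_cost M l has_derivative (*) (link_cost_deriv M l (link_flow M h $ l)))
        (at (link_flow M h $ l) within {0..})"
      using link_cost_deriv[OF M arc[OF True]] nonneg h by (simp add: has_field_derivative_def)
    then have "(link_cost M l has_derivative (*) (link_cost_deriv M l (link_flow M h $ l)))
        (at (link_flow M h $ l) within (\<lambda>x. link_flow M x $ l) ` ?S)"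
      by (rule has_derivative_subset) (use nonneg in auto)
    from diff_chain_within[OF lin this] show ?thesis
      by (auto simp: o_def intro!: has_derivative_mult_right)
  qed (simp add: incidence_def)
  have "((\<lambda>x. \<chi> i. \<Sum>l\<in>UNIV. incidence M $ l $ i * link_cost M l (link_flow M x $ l)) has_derivative
      (\<lambda>x. \<chi> i. \<Sum>l\<in>UNIV. incidence M $ l $ i * (link_cost_deriv M l (link_flow M h $ l) * link_flow M x $ l)))
      (at h within ?S)"
    by (subst has_derivative_componentwise_within)
      (auto simp: Basis_vec_def inner_axis intro!: has_derivative_sum cost_term)
  moreover have "path_cost M = (\<lambda>x. \<chi> i. \<Sum>l\<in>UNIV. incidence M $ l $ i * link_cost M l (link_flow M x $ l))"
    by (simp add: fun_eq_iff path_cost_def matrix_vector_mult_def transpose_def)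
  moreover have "(*v) (path_cost_jacobian M h) =
      (\<lambda>x. \<chi> i. \<Sum>l\<in>UNIV. incidence M $ l $ i * (link_cost_deriv M l (link_flow M h $ l) * link_flow M x $ l))"
  proof
    fix x
    have "path_cost_jacobian M h *v x = transpose (incidence M) *v
        ((\<chi> l m. if l = m then link_cost_deriv M l (link_flow M h $ l) else 0) *v link_flow M x)"
      by (simp add: path_cost_jacobian_def link_flow_def matrix_vector_mul_assoc matrix_mul_assoc)
    also have "(\<chi> l m. if l = m then link_cost_deriv M l (link_flow M h $ l) else 0) *v link_flow M x =
        (\<chi> l. link_cost_deriv M l (link_flow M h $ l) * link_flow M x $ l)"
      by (simp add: matrix_vector_mult_def if_distrib[of "\<lambda>a. a * _"] cong: if_cong)
    finally show "path_cost_jacobian M h *v x =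
      (\<chi> i. \<Sum>l\<in>UNIV. incidence M $ l $ i * (link_cost_deriv M l (link_flow M h $ l) * link_flow M x $ l))"
      by (simp add: matrix_vector_mult_def transpose_def)
  qed
  ultimately show ?thesis by simp
qed

end

theory Submission
  imports Defs
begin

text \<open>
  The vectors whose entries sum to zero over every OD pair form a subspace. It contains the residual,
  because the logit probabilities of an OD pair sum to one; differentiating this identity shows that
  it also contains the range of the reduced Jacobian. Hence it contains every Krylov space.
\<close>

text \<open>All \<open>w\<close> are allowed, not only those in \<open>od_pairs M\<close>: a pair
  without paths contributes an empty sum, so the set needs no reference to
  \<open>od_pairs\<close>.\<close>

definition balanced :: "('v, 'l, 'p::finite) traffic_model \<Rightarrow> (real ^ 'p) set" where
  "balanced M = {x. \<forall>w. (\<Sum>j\<in>paths_of M w. x $ j) = 0}"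

lemma subspace_balanced: "subspace (balanced M)"
  by (auto simp: subspace_def balanced_def sum.distrib simp flip: sum_distrib_left)

text \<open>Invariance under \<open>A\<close> keeps every generator in \<open>S\<close>, and a span
  is the least subspace containing its generators.\<close>

lemma krylov_subset:
  fixes A :: "real ^ 'n::finite ^ 'n"
  assumes "subspace S" "r \<in> S" "\<And>x. x \<in> S \<Longrightarrow> A *v x \<in> S"
  shows "krylov A r b \<subseteq> S"
proof -
  have "((*v) A ^^ k) r \<in> S" for k
    by (induction k) (use assms in auto)
  then show ?thesis
    unfolding krylov_def using assms(1) by (intro span_minimal) auto
qed

text \<open>The path \<open>i\<close> belongs to the index set itself, so the sum of positive
  exponentials is not empty.\<close>

lemma logit_denominator_pos:
  fixes c :: "real ^ 'p::finite"
  shows "0 < (\<Sum>j\<in>paths_of M (od_of M i). exp (- theta M * c $ j))"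
  by (intro sum_pos) (auto simp: paths_of_def)

lemma sum_logit_prob:
  fixes c :: "real ^ 'p::finite"
  assumes "paths_of M w \<noteq> {}"
  shows "(\<Sum>i\<in>paths_of M w. logit_prob M c $ i) = 1"
proof -
  from assms obtain i where i: "od_of M i = w"
    by (auto simp: paths_of_def)
  \<comment> \<open>All paths of \<open>w\<close> share one denominator, which equals the sum of
    their numerators.\<close>
  have "(\<Sum>i\<in>paths_of M w. logit_prob M c $ i) =
      (\<Sum>i\<in>paths_of M w. exp (- theta M * c $ i) / (\<Sum>j\<in>paths_of M w. exp (- theta M * c $ j)))"
    by (intro sum.cong) (auto simp: logit_prob_def paths_of_def)
  also have "\<dots> = 1"
    using logit_denominator_pos[where M = M and i = i and c = c] i by (simp flip: sum_divide_distrib)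
  finally show ?thesis .
qed

text \<open>Each component is a quotient of smooth functions with positive denominator.\<close>

lemma logit_prob_differentiable:
  fixes c :: "real ^ 'p::finite"
  shows "logit_prob M differentiable at c"
proof -
  have exp_term: "(\<lambda>c::real ^ 'p. exp (- theta M * c $ j)) differentiable at c" for j
    unfolding differentiable_def
    by (rule exI) (auto intro!: derivative_eq_intros bounded_linear.has_derivative[OF bounded_linear_vec_nth])
  have "(\<lambda>c::real ^ 'p. exp (- theta M * c $ i) / (\<Sum>j\<in>paths_of M (od_of M i). exp (- theta M * c $ j)))
      differentiable at c" for i
    using logit_denominator_pos[where M = M and i = i and c = c]
    by (intro differentiable_divide exp_term differentiable_sum) (auto intro: exp_term[simplified])
  then show ?thesis
    unfolding differentiable_componentwise_within[of "logit_prob M"]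
    by (auto simp: Basis_vec_def inner_axis logit_prob_def)
qed

lemma sum_frechet_derivative_logit_prob:
  fixes c y :: "real ^ 'p::finite"
  shows "(\<Sum>i\<in>paths_of M w. frechet_derivative (logit_prob M) (at c) y $ i) = 0"
proof (cases "paths_of M w = {}")
  case False
  have "(logit_prob M has_derivative frechet_derivative (logit_prob M) (at c)) (at c)"
    using logit_prob_differentiable by (simp add: frechet_derivative_works)
  then have "((\<lambda>c. \<Sum>i\<in>paths_of M w. logit_prob M c $ i) has_derivative
      (\<lambda>y. \<Sum>i\<in>paths_of M w. frechet_derivative (logit_prob M) (at c) y $ i)) (at c)"
    by (intro has_derivative_sum bounded_linear.has_derivative[OF bounded_linear_vec_nth])
  \<comment> \<open>The differentiated sum is the constant 1, whose derivative is also 0; uniqueness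
    of derivatives equates the two.\<close>
  then have "((\<lambda>c::real ^ 'p. 1::real) has_derivative
      (\<lambda>y. \<Sum>i\<in>paths_of M w. frechet_derivative (logit_prob M) (at c) y $ i)) (at c)"
    by (simp add: sum_logit_prob[OF False])
  from has_derivative_unique[OF this has_derivative_const] show ?thesis
    by (rule fun_cong)
qed simp

text \<open>Turns the matrix product in \<open>reduced_jacobian\<close> into a composition of
  derivatives, to which the sum identities apply.\<close>

lemma jacobian_mult_vec:
  fixes f :: "real ^ 'n::finite \<Rightarrow> real ^ 'm::finite"
  assumes "f differentiable at x"
  shows "jacobian f (at x) *v y = frechet_derivative f (at x) y"
  using assms unfolding jacobian_def
  by (simp add: matrix_works linear_matrix_vector_mul_eq linear_frechet_derivative)

lemma linear_spread: "linear (spread M h)"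
  by (rule linearI) (simp_all add: spread_def vec_eq_iff algebra_simps)

text \<open>The factor by which \<open>spread\<close> scales an entry is the total flow of its OD
  pair, hence the same for all paths of \<open>w\<close>.\<close>

lemma sum_spread:
  "(\<Sum>i\<in>paths_of M w. spread M h p $ i) = (\<Sum>j\<in>paths_of M w. h $ j) * (\<Sum>i\<in>paths_of M w. p $ i)"
  unfolding sum_distrib_left by (intro sum.cong) (auto simp: spread_def paths_of_def)

text \<open>The logit map only redistributes the total of \<open>h\<close> within each OD pair, so
  subtracting \<open>h\<close> cancels that total.\<close>

lemma logit_residual_balanced: "logit_residual M h \<in> balanced M"
proof -
  have "(\<Sum>j\<in>paths_of M w. logit_residual M h $ j) = 0" for w
    by (cases "paths_of M w = {}")
      (simp_all add: logit_residual_def logit_map_def sum_subtractf sum_spread sum_logit_prob)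
  then show ?thesis by (simp add: balanced_def)
qed

lemma reduced_jacobian_balanced: "reduced_jacobian M h *v x \<in> balanced M"
proof -
  let ?c = "path_cost M h"
  \<comment> \<open>Being linear, \<open>spread M h\<close> is its own derivative at every
    point.\<close>
  have "(spread M h has_derivative spread M h) (at p)" for p
    by (intro linear_imp_has_derivative linear_spread)
  then have "jacobian (spread M h) (at p) *v y = spread M h y" for p y
    by (metis differentiableI frechet_derivative_at jacobian_mult_vec)
  then have "reduced_jacobian M h *v x =
      spread M h (frechet_derivative (logit_prob M) (at ?c) (path_cost_jacobian M h *v x))"
    by (simp add: reduced_jacobian_def Let_def jacobian_mult_vec logit_prob_differentiable
        flip: matrix_vector_mul_assoc)
  then show ?thesis
    by (simp add: balanced_def sum_spread sum_frechet_derivative_logit_prob)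
qed

theorem proposition1:
  fixes M :: "('v, 'l::finite, 'p::finite) traffic_model"
    and h \<delta> :: "real ^ 'p" and tol :: real
  assumes "traffic_assignment M"
    and "feasible M h"
    and "0 \<le> tol"
    and "gmres_output (mat 1 - reduced_jacobian M h) (logit_residual M h) tol \<delta>"
  shows "\<forall>w\<in>od_pairs M. (\<Sum>j\<in>paths_of M w. \<delta> $ j) = 0"
proof -
  obtain b where "\<delta> \<in> krylov (mat 1 - reduced_jacobian M h) (logit_residual M h) b"
    using assms(4)
    by (auto simp: gmres_output_def gmres_meets_def gmres_iterate_def is_arg_min_def)
  \<comment> \<open>For balanced \<open>x\<close>, the matrix
    \<open>mat 1 - reduced_jacobian M h\<close> yields a difference of two balanced vectors, so
    \<open>balanced M\<close> is invariant.\<close>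
  moreover have "krylov (mat 1 - reduced_jacobian M h) (logit_residual M h) b \<subseteq> balanced M"
    by (intro krylov_subset subspace_balanced logit_residual_balanced)
      (simp add: matrix_vector_mult_diff_rdistrib subspace_diff[OF subspace_balanced]
        reduced_jacobian_balanced)
  ultimately show ?thesis
    by (auto simp: balanced_def)
qed

end
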